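(* Consider a continuous all-pay auction with $N\ge 2$ buyers, in quantile coordinates, with canonical equilibrium bidding strategy $\beta$. Let $M>0$ and let $\Lambda$ be a set of bidding profiles $\lambda=(\lambda_i)_{i\in[N]}$, $\lambda_i:[0,1]\to B$, containing the profile in which every buyer uses $\beta$, and such that every $\lambda\in\Lambda$ is symmetric ($\lambda_i=\lambda_j$ for all $i,j$), each $\lambda_i$ is strictly increasing and differentiable, $\lambda_i(0)=0$, and $\lambda_i<M$. For $\lambda\in\Lambda$ and $\theta_i\in[0,1]$ let $$\alpha(\theta_i|\lambda)=\theta_i^{N-2}\cdot\begin{cases}\frac{(\lambda_i(\theta_i)-\beta(\theta_i))^2}{2} & \lambda_i(\theta_i)\le\beta(1),\\ \frac{(\beta(1)-\beta(\theta_i))^2}{2}+(\beta(1)-\beta(\theta_i))(\lambda_i(\theta_i)-\beta(1)) & \lambda_i(\theta_i)>\beta(1).\end{cases}$$ Then $\epsilon(\theta_i)=\theta_i^{N-2}\left(\beta(1)-\beta(\theta_i)\right)$ together with $\gamma=0$ is a feasible solution, of value $0$, of the infinite linear program $$\inf_{\epsilon\ge0,\ \gamma\in\mathbb{R}}\ \gamma\quad\text{s.t.}\quad \gamma+\sum_{i\in[N]}\int_0^1 d\theta_i\,\epsilon(\theta_i)\left(U_i(\beta,\lambda_{-i}|\theta_i)-U_i(\lambda|\theta_i)\right)\ \ge\ \sum_{i\in[N]}\int_0^1 d\theta_i\,\alpha(\theta_i|\lambda)\quad\forall\,\lambda\in\Lambda .$$ As a consequence, if a Borel probability measure $\sigma$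 on $\Lambda$ (with respect to the sup-norm topology) is a continuous Bayesian coarse correlated equilibrium, then $\sigma$ places probability $1$ on the equilibrium bidding strategies $\beta$.
   Context: Continuous auction in quantile coordinates. There are $N\ge2$ buyers with i.i.d. valuations drawn from a c.d.f. $F$ with a probability density of full support on the interval $V=[0,v(1)]\subset\mathbb{R}_+$; bids lie in an interval $B=[0,\max B]\supseteq V$. Set $v=F^{-1}:[0,1]\to V$, assumed continuous and strictly increasing on $[0,1]$ (so $v(0)=0$) and $C^\infty$ on $(0,1]$. Types $\theta_i$ are i.i.d. uniform on $[0,1]$, and a buyer of type $\theta_i$ has valuation $v(\theta_i)$. A bidding strategy of buyer $i$ is $\lambda_i:[0,1]\to B$, and $\lambda(\theta)=(\lambda_i(\theta_i))_i$. Allocation (uniform tie-breaking): $x_i(b)=1/|\arg\max_j b_j|$ if $i\in\arg\max_j b_j$, and $x_i(b)=0$ otherwise. All-pay utility: $u_i(b|w)=x_i(b)w-b_i$ for valuation $w$. Expected utilities: $U_i(\lambda|\theta_i)=\int_{[0,1]^{N-1}}d\theta_{-i}\,u_i(\lambda(\theta)|v(\theta_i))$; $U_i(b',\lambda_{-i}|\theta_i)$ is the same with buyer $i$'s bid replaced by the constant $b'$; and $U_i(\beta,\lambda_{-i}|\theta_i):=U_i(\beta(\theta_i),\lambda_{-i}|\theta_i)$. Canonical all-pay equilibrium: $\beta(\theta)=\int_0^\theta (N-1)t^{N-2}v(t)\,dt$. In the dual program, $\epsilon$ ranges over non-negative continuous functions on $[0,1]$. A continuous Bayesian coarse correlated equilibrium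 (BCCE) with support in $\Lambda$ is a Borel probability measure $\sigma$ on $\Lambda$ such that for all $i\in[N]$, $\theta_i\in[0,1]$, $b'_i\in B$: $\int_\Lambda d\sigma(\lambda)\left(U_i(b'_i,\lambda_{-i}|\theta_i)-U_i(\lambda|\theta_i)\right)\le0$. *)

theory Defs
  imports "HOL-Probability.Probability"
begin

text \<open>
  The buyers are the elements of \<open>{1..N}\<close>.  A bidding profile \<open>l\<close> is a function of type
  \<open>nat \<Rightarrow> real \<Rightarrow> real\<close>; the value \<open>l i t\<close> is the bid of buyer \<open>i\<close> when of type \<open>t\<close>.
  Profiles are taken extensional, on \<open>{1..N}\<close> and on \<open>{0..1}\<close>, so that equality
  of profiles is equality of the functions \<open>[0,1] \<rightarrow> B\<close> they represent.
\<close>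

type_synonym profile = "nat \<Rightarrow> real \<Rightarrow> real"

definition bid_profiles :: "nat \<Rightarrow> real set \<Rightarrow> profile set" where
  "bid_profiles N B = {1..N} \<rightarrow>\<^sub>E ({0..1} \<rightarrow>\<^sub>E B)"

section \<open>Valuations\<close>

text \<open>The support of a measure is the set of points all of whose neighbourhoods have positive mass.\<close>

definition has_full_support_density :: "(real \<Rightarrow> real) \<Rightarrow> real set \<Rightarrow> bool" where
  "has_full_support_density F V \<longleftrightarrow>
     (\<exists>f \<in> borel_measurable borel.
        (\<forall>x. 0 \<le> f x) \<and>
        prob_space (density lborel (\<lambda>x. ennreal (f x))) \<and>
        F = cdf (density lborel (\<lambda>x. ennreal (f x))) \<and>
        {x. \<forall>U. open U \<longrightarrow> x \<in> U \<longrightarrow> 0 < emeasure (density lborel (\<lambda>x. ennreal (f x))) U} = V)"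

text \<open>\<open>v = F\<^sup>-\<^sup>1 : [0,1] \<rightarrow> V\<close>, the inverse of the restriction of \<open>F\<close> to \<open>V\<close>.\<close>

definition quantile_function :: "(real \<Rightarrow> real) \<Rightarrow> real set \<Rightarrow> (real \<Rightarrow> real) \<Rightarrow> bool" where
  "quantile_function F V v \<longleftrightarrow>
     (\<forall>t\<in>{0..1}. v t \<in> V \<and> F (v t) = t) \<and> (\<forall>x\<in>V. v (F x) = x)"

text \<open>
  \<open>D k\<close> is the \<open>k\<close>-th derivative.  Derivatives are taken within \<open>S\<close>, hence are one-sided
  at an endpoint of an interval that belongs to the interval.
\<close>

definition Cinf_on :: "real set \<Rightarrow> (real \<Rightarrow> real) \<Rightarrow> bool" where
  "Cinf_on S f \<longleftrightarrow>
     (\<exists>D :: nat \<Rightarrow> real \<Rightarrow> real.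
        (\<forall>x\<in>S. D 0 x = f x) \<and>
        (\<forall>k. \<forall>x\<in>S. (D k has_real_derivative D (Suc k) x) (at x within S)))"

section \<open>The all-pay auction\<close>

definition winners :: "nat \<Rightarrow> (nat \<Rightarrow> real) \<Rightarrow> nat set" where
  "winners N b = {j. is_arg_max b (\<lambda>k. k \<in> {1..N}) j}"

definition alloc :: "nat \<Rightarrow> nat \<Rightarrow> (nat \<Rightarrow> real) \<Rightarrow> real" where
  "alloc N i b = (if i \<in> winners N b then 1 / real (card (winners N b)) else 0)"

definition util :: "nat \<Rightarrow> nat \<Rightarrow> (nat \<Rightarrow> real) \<Rightarrow> real \<Rightarrow> real" where
  "util N i b w = alloc N i b * w - b i"

abbreviation unit_interval :: "real measure" where
  "unit_interval \<equiv> restrict_space lborel {0..1}"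

definition other_types :: "nat \<Rightarrow> nat \<Rightarrow> (nat \<Rightarrow> real) measure" where
  "other_types N i = PiM ({1..N} - {i}) (\<lambda>_. unit_interval)"

text \<open>In \<open>expected_util\<close>, \<open>\<theta>(i := t)\<close> is the full vector of types, buyer \<open>i\<close> having type \<open>t\<close>.\<close>

definition expected_util ::
    "nat \<Rightarrow> (real \<Rightarrow> real) \<Rightarrow> nat \<Rightarrow> profile \<Rightarrow> real \<Rightarrow> real" where
  "expected_util N v i l t =
     (LINT \<theta>|other_types N i. util N i (\<lambda>j. l j ((\<theta>(i := t)) j)) (v t))"

text \<open>\<open>U\<^sub>i(b', l\<^sub>-\<^sub>i | t)\<close>.\<close>

definition deviation_util ::
    "nat \<Rightarrow> (real \<Rightarrow> real) \<Rightarrow> nat \<Rightarrow> real \<Rightarrow> profile \<Rightarrow> real \<Rightarrow> real" where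
  "deviation_util N v i b' l t =
     (LINT \<theta>|other_types N i. util N i ((\<lambda>j. l j ((\<theta>(i := t)) j))(i := b')) (v t))"

definition canonical_bid :: "nat \<Rightarrow> (real \<Rightarrow> real) \<Rightarrow> real \<Rightarrow> real" where
  "canonical_bid N v t = (LINT s:{0..t}|lborel. (real N - 1) * s ^ (N - 2) * v s)"

definition canonical_profile :: "nat \<Rightarrow> (real \<Rightarrow> real) \<Rightarrow> profile" where
  "canonical_profile N v = (\<lambda>i\<in>{1..N}. \<lambda>t\<in>{0..1}. canonical_bid N v t)"

section \<open>Continuous Bayesian coarse correlated equilibria\<close>

text \<open>
  The metric on profiles is
  \<open>d(l, m) = sup\<^sub>i sup\<^sub>t \<bar>l\<^sub>i(t) - m\<^sub>i(t)\<bar>\<close>, and \<open>\<Lambda>\<close> carries the subspace topology.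
\<close>

definition sup_norm_topology :: "nat \<Rightarrow> profile topology" where
  "sup_norm_topology N = mtopology_of (funspace {1..N} (funspace {0..1} euclidean_metric))"

definition borel_profiles :: "nat \<Rightarrow> profile set \<Rightarrow> profile measure" where
  "borel_profiles N \<Lambda> = sigma \<Lambda> {W. openin (subtopology (sup_norm_topology N) \<Lambda>) W}"

definition borel_prob_on :: "nat \<Rightarrow> profile set \<Rightarrow> profile measure \<Rightarrow> bool" where
  "borel_prob_on N \<Lambda> \<sigma> \<longleftrightarrow> prob_space \<sigma> \<and> space \<sigma> = \<Lambda> \<and> sets \<sigma> = sets (borel_profiles N \<Lambda>)"

definition BCCE ::
    "nat \<Rightarrow> (real \<Rightarrow> real) \<Rightarrow> real set \<Rightarrow> profile set \<Rightarrow> profile measure \<Rightarrow> bool" where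
  "BCCE N v B \<Lambda> \<sigma> \<longleftrightarrow>
     borel_prob_on N \<Lambda> \<sigma> \<and>
     (\<forall>i\<in>{1..N}. \<forall>t\<in>{0..1}. \<forall>b'\<in>B.
        (LINT l|\<sigma>. deviation_util N v i b' l t - expected_util N v i l t) \<le> 0)"

section \<open>The dual linear program\<close>

definition alpha :: "nat \<Rightarrow> (real \<Rightarrow> real) \<Rightarrow> nat \<Rightarrow> profile \<Rightarrow> real \<Rightarrow> real" where
  "alpha N v i l t =
     (let \<beta> = canonical_bid N v in
      t ^ (N - 2) *
        (if l i t \<le> \<beta> 1
         then (l i t - \<beta> t)\<^sup>2 / 2
         else (\<beta> 1 - \<beta> t)\<^sup>2 / 2 + (\<beta> 1 - \<beta> t) * (l i t - \<beta> 1)))"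

text \<open>
  The integrability conditions exclude that the constraint holds merely because the integral
  of a non-integrable function is \<open>0\<close> by convention.
\<close>

definition dual_feasible ::
    "nat \<Rightarrow> (real \<Rightarrow> real) \<Rightarrow> profile set \<Rightarrow> (real \<Rightarrow> real) \<Rightarrow> real \<Rightarrow> bool" where
  "dual_feasible N v \<Lambda> \<epsilon> \<gamma> \<longleftrightarrow>
     continuous_on {0..1} \<epsilon> \<and> (\<forall>t\<in>{0..1}. 0 \<le> \<epsilon> t) \<and>
     (\<forall>l\<in>\<Lambda>.
        (\<forall>i\<in>{1..N}.
           integrable unit_interval
             (\<lambda>t. \<epsilon> t * (deviation_util N v i (canonical_bid N v t) l t - expected_util N v i l t)) \<and>
           integrable unit_interval (alpha N v i l)) \<and>
        \<gamma> + (\<Sum>i\<in>{1..N}. LINT t|unit_interval.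
               \<epsilon> t * (deviation_util N v i (canonical_bid N v t) l t - expected_util N v i l t))
          \<ge> (\<Sum>i\<in>{1..N}. LINT t|unit_interval. alpha N v i l t))"

definition dual_objective :: "(real \<Rightarrow> real) \<Rightarrow> real \<Rightarrow> real" where
  "dual_objective \<epsilon> \<gamma> = \<gamma>"

end

theory Submission
  imports Defs
begin

text \<open>
  For a symmetric profile with common increasing strategy \<open>f\<close>, a bid \<open>b\<close> wins with probability
  \<open>q(b)\<^sup>n\<close>, where \<open>n = N - 1\<close> and \<open>q(b)\<close> is the measure of \<open>{s. f(s) < b}\<close>. As
  \<open>\<beta>'(t) = n t\<^bsup>n-1\<^esup> v(t)\<close> and \<open>q(b)\<^sup>n\<close> is the integral of \<open>n s\<^bsup>n-1\<^esup>\<close> over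
  \<open>{s. f(s) < b}\<close>, exchanging the order of integration turns the integral of
  \<open>\<beta>'(t) (\<beta>(1) - \<beta>(t)) q(\<beta>(t))\<^sup>n\<close> into the integral of
  \<open>n s\<^bsup>n-1\<^esup> max(0, \<beta>(1) - f(s))\<^sup>2 / 2\<close>. Subtracting the same identity for \<open>f = \<beta>\<close> shows that
  the dual constraint holds with equality. Integrating the equilibrium inequalities at
  \<open>b' = \<beta>(t)\<close> against \<open>\<epsilon>\<close> then forces the nonnegative integral of \<open>\<alpha>\<close> to vanish for almost
  every profile, which by continuity leaves only \<open>\<beta>\<close>.
\<close>

section \<open>Lebesgue measure on the unit interval\<close>

lemma prob_space_unit_interval: "prob_space unit_interval"
  by (rule prob_spaceI) (simp add: emeasure_restrict_space space_restrict_space)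

lemma space_unit_interval [simp]: "space unit_interval = {0..1}"
  by (simp add: space_restrict_space)

lemma sets_unit_interval: "A \<subseteq> {0..1} \<Longrightarrow> A \<in> sets borel \<Longrightarrow> A \<in> sets unit_interval"
  by (auto simp: sets_restrict_space_iff)

lemma borel_measurable_unit_intervalI:
  "f \<in> borel_measurable (restrict_space borel {0..1}) \<Longrightarrow> f \<in> borel_measurable unit_interval"
  by (subst measurable_cong_sets[OF sets_restrict_space_cong[OF sets_lborel] refl])

lemma strict_mono_on_borel_measurable_unit_interval:
  "strict_mono_on {0..1} f \<Longrightarrow> f \<in> borel_measurable unit_interval" for f :: "real \<Rightarrow> real"
  by (intro borel_measurable_unit_intervalI borel_measurable_mono_on_fnc strict_mono_on_imp_mono_on)

lemma continuous_on_borel_measurable_unit_interval: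
  "continuous_on {0..1} f \<Longrightarrow> f \<in> borel_measurable unit_interval" for f :: "real \<Rightarrow> real"
  by (intro borel_measurable_unit_intervalI borel_measurable_continuous_on_restrict)

lemma integral_unit_interval:
  fixes f :: "real \<Rightarrow> real"
  shows "(LINT t|unit_interval. f t) = (LINT t|lborel. indicator {0..1} t *\<^sub>R f t)"
  by (rule integral_restrict_space) simp

lemma AE_unit_interval_neq: "AE s in unit_interval. s \<in> {0..1} \<and> s \<noteq> c"
proof -
  have "AE s in lborel. s \<noteq> c" by (rule AE_lborel_singleton)
  then show ?thesis
    by (auto simp: AE_restrict_space_iff elim: eventually_mono)
qed

lemma sets_unit_interval_less:
  fixes f :: "real \<Rightarrow> real"
  assumes "f \<in> borel_measurable unit_interval"
  shows "{s \<in> {0..1}. f s < b} \<in> sets unit_interval"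
  using borel_measurable_less[OF assms borel_measurable_const[of b]] by simp

section \<open>The probability of winning\<close>

text \<open>The quantity q(b): the probability that one given rival, with uniform type and strategy
  \<open>f\<close>, bids strictly below \<open>b\<close>.\<close>

definition win_measure :: "(real \<Rightarrow> real) \<Rightarrow> real \<Rightarrow> real" where
  "win_measure f b = measure unit_interval {s \<in> {0..1}. f s < b}"

lemma win_measure_nonneg: "0 \<le> win_measure f b"
  by (simp add: win_measure_def)

lemma win_measure_le_1: "win_measure f b \<le> 1"
  unfolding win_measure_def by (rule prob_space.prob_le_1[OF prob_space_unit_interval])

lemma win_measure_self:
  assumes "strict_mono_on {0..1} f" "t \<in> {0..1}"
  shows "win_measure f (f t) = t"
proof -
  have "{s \<in> {0..1}. f s < f t} = {0..<t}"
    using assms by (auto simp: strict_mono_on_less)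
  then show ?thesis
    using assms by (simp add: win_measure_def measure_restrict_space atLeastLessThan_subseteq_atLeastAtMost_iff)
qed

text \<open>Replaces the number of maximisers by a finite sum of indicators of comparisons, a form
  whose measurability in the bids is immediate.\<close>

lemma alloc_eq:
  assumes "i \<in> {1..N}"
  shows "alloc N i b =
    (if \<forall>j\<in>{1..N}. b j \<le> b i then 1 / (\<Sum>j\<in>{1..N}. of_bool (b j = b i)) else 0)"
proof -
  have win: "i \<in> winners N b \<longleftrightarrow> (\<forall>j\<in>{1..N}. b j \<le> b i)"
    using assms unfolding winners_def is_arg_max_def by (auto simp: not_less)
  have "real (card (winners N b)) = (\<Sum>j\<in>{1..N}. of_bool (b j = b i))"
    if max: "\<forall>j\<in>{1..N}. b j \<le> b i"
  proof -
    have "winners N b = {j\<in>{1..N}. b j = b i}"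
    proof (intro set_eqI iffI)
      fix j assume "j \<in> winners N b"
      then have "j \<in> {1..N}" "\<not> b i > b j"
        using assms by (auto simp: winners_def is_arg_max_def)
      then show "j \<in> {j\<in>{1..N}. b j = b i}"
        using max by force
    next
      fix j assume "j \<in> {j\<in>{1..N}. b j = b i}"
      then show "j \<in> winners N b"
        using max by (auto simp: winners_def is_arg_max_def not_less)
    qed
    then show ?thesis
      by (simp add: of_bool_def sum.If_cases Int_def)
  qed
  then show ?thesis
    using win by (simp add: alloc_def)
qed

lemma borel_measurable_alloc:
  fixes b :: "'a \<Rightarrow> nat \<Rightarrow> real"
  assumes i: "i \<in> {1..N}" and b: "\<And>j. j \<in> {1..N} \<Longrightarrow> (\<lambda>x. b x j) \<in> borel_measurable M"
  shows "(\<lambda>x. alloc N i (b x)) \<in> borel_measurable M"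
proof -
  note [measurable] = b b[OF i]
  show ?thesis
    unfolding alloc_eq[OF i] by measurable
qed

text \<open>When no rival matches the bid of \<open>i\<close>, only the term \<open>j = i\<close> of
  the sum in \<open>alloc_eq\<close> survives, and the tie-breaking rule disappears.\<close>

lemma alloc_no_tie:
  assumes "i \<in> {1..N}" "\<forall>j\<in>{1..N} - {i}. b j \<noteq> b i"
  shows "alloc N i b = of_bool (\<forall>j\<in>{1..N} - {i}. b j < b i)"
proof -
  have "(\<Sum>j\<in>{1..N}. of_bool (b j = b i)) = (1::real)"
  proof -
    have "(\<Sum>j\<in>{1..N}. of_bool (b j = b i)) = (\<Sum>j\<in>{1..N}. if j = i then 1 else (0::real))"
      using assms by (intro sum.cong) auto
    then show ?thesis using assms by simp
  qed
  moreover have "(\<forall>j\<in>{1..N}. b j \<le> b i) \<longleftrightarrow> (\<forall>j\<in>{1..N} - {i}. b j < b i)"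
    using assms by (metis Diff_iff insertI1 less_le order_refl singletonD)
  ultimately show ?thesis
    by (simp add: alloc_eq[OF assms(1)])
qed

text \<open>A tie at \<open>b\<close> is a null event because \<open>f\<close> is injective. Off
  ties, buyer \<open>i\<close> wins exactly when all rival types lie in {f < b}, and each of the
  \<open>N - 1\<close> independent rivals contributes one factor
  \<open>win_measure f b\<close>.\<close>

lemma deviation_util_eq:
  assumes i: "i \<in> {1..N}" and sym: "\<forall>j\<in>{1..N}. l j = f" and f: "strict_mono_on {0..1} f"
  shows "deviation_util N v i b l t = win_measure f b ^ (N - 1) * v t - b"
proof -
  interpret U: prob_space unit_interval by (rule prob_space_unit_interval)
  interpret P: finite_product_prob_space "\<lambda>_. unit_interval" "{1..N} - {i}"
    by unfold_locales simp
  have fm[measurable]: "f \<in> borel_measurable unit_interval"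
    by (rule strict_mono_on_borel_measurable_unit_interval[OF f])
  let ?bid = "\<lambda>\<theta>. (\<lambda>j. l j ((\<theta>(i := t)) j))(i := b)"
  let ?A = "PiE ({1..N} - {i}) (\<lambda>_. {s \<in> {0..1}. f s < b})"
  have S: "{s \<in> {0..1}. f s < b} \<in> sets unit_interval"
    by (rule sets_unit_interval_less[OF fm])
  have bid: "?bid \<theta> j = f (\<theta> j)" if "j \<in> {1..N} - {i}" for \<theta> j
    using that sym by simp
  have meas: "(\<lambda>\<theta>. alloc N i (?bid \<theta>)) \<in> borel_measurable (other_types N i)"
  proof (rule borel_measurable_alloc[OF i])
    fix j assume j: "j \<in> {1..N}"
    show "(\<lambda>\<theta>. ?bid \<theta> j) \<in> borel_measurable (other_types N i)"
    proof (cases "j = i")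
      case False
      then have [measurable]: "(\<lambda>\<theta>. \<theta> j) \<in> measurable (other_types N i) unit_interval"
        unfolding other_types_def using j by (intro measurable_component_singleton) auto
      have "(\<lambda>\<theta>. f (\<theta> j)) \<in> borel_measurable (other_types N i)"
        by measurable
      then show ?thesis using bid j False by simp
    qed simp
  qed
  have AE: "AE \<theta> in other_types N i. alloc N i (?bid \<theta>) = indicator ?A \<theta>"
  proof -
    \<comment> \<open>At most one type bids \<open>b\<close>, and a single point is null.\<close>
    have ne: "AE s in unit_interval. f s \<noteq> b"
    proof (cases "\<exists>s0\<in>{0..1}. f s0 = b")
      case True
      then obtain s0 where s0: "s0 \<in> {0..1}" "f s0 = b" by blast
      show ?thesis
        using AE_unit_interval_neq[of s0]
        by (rule eventually_mono) (use s0 strict_mono_on_eqD[OF f, of s0] in auto)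
    next
      case False
      show ?thesis
        using AE_unit_interval_neq[of 0] by (rule eventually_mono) (use False in auto)
    qed
    have "AE \<theta> in other_types N i. \<forall>j\<in>{1..N} - {i}. f (\<theta> j) \<noteq> b"
      unfolding other_types_def
      by (intro AE_finite_allI) (auto intro!: AE_PiM_component[OF prob_space_unit_interval _ ne])
    moreover have "AE \<theta> in other_types N i. \<theta> \<in> space (other_types N i)" by (rule AE_space)
    ultimately show ?thesis
    proof eventually_elim
      case (elim \<theta>)
      have "alloc N i (?bid \<theta>) = of_bool (\<forall>j\<in>{1..N} - {i}. ?bid \<theta> j < ?bid \<theta> i)"
        using elim(1) sym by (intro alloc_no_tie[OF i]) simp
      also have "\<dots> = of_bool (\<forall>j\<in>{1..N} - {i}. f (\<theta> j) < b)"
        using bid[of _ \<theta>] by auto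
      also have "\<dots> = indicator ?A \<theta>"
        using elim(2) by (auto simp: other_types_def space_PiM PiE_iff indicator_def)
      finally show ?case .
    qed
  qed
  have A: "?A \<in> sets (other_types N i)"
    unfolding other_types_def using S by (intro sets_PiM_I_finite) auto
  have prob: "prob_space (other_types N i)"
    unfolding other_types_def by (rule P.prob_space_axioms)
  have "deviation_util N v i b l t =
      (LINT \<theta>|other_types N i. indicator ?A \<theta> * v t - b)"
    unfolding deviation_util_def util_def using AE A meas
    by (intro integral_cong_AE) (auto elim: eventually_mono)
  also have "\<dots> = (LINT \<theta>|other_types N i. indicator ?A \<theta> * v t) - (LINT \<theta>|other_types N i. b)"
    using A prob by (intro Bochner_Integration.integral_diff)
      (auto simp: prob_space.finite_measure finite_measure.integrable_const
        finite_measure.emeasure_finite[OF prob_space.finite_measure] less_top[symmetric])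
  also have "(LINT \<theta>|other_types N i. b) = b"
    using prob_space.prob_space[OF prob] by simp
  also have "(LINT \<theta>|other_types N i. indicator ?A \<theta> * v t) = measure (other_types N i) ?A * v t"
    using A by (simp add: Int_absorb2 sets.sets_into_space)
  also have "measure (other_types N i) ?A = (\<Prod>j\<in>{1..N} - {i}. win_measure f b)"
    unfolding other_types_def win_measure_def using S by (subst P.prob_times) auto
  also have "\<dots> = win_measure f b ^ (N - 1)"
    using i by simp
  finally show ?thesis .
qed

text \<open>For type \<open>t\<close>, following the profile is the same as deviating to the
  constant bid \<open>f t\<close>, which outbids exactly the rival types below
  \<open>t\<close>.\<close>

lemma expected_util_eq:
  assumes "i \<in> {1..N}" "\<forall>j\<in>{1..N}. l j = f" "strict_mono_on {0..1} f" "t \<in> {0..1}"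
  shows "expected_util N v i l t = t ^ (N - 1) * v t - f t"
proof -
  have "(\<lambda>j. l j ((\<theta>(i := t)) j)) = ((\<lambda>j. l j ((\<theta>(i := t)) j))(i := f t))" for \<theta>
    using assms(1,2) by auto
  then have "expected_util N v i l t = deviation_util N v i (f t) l t"
    unfolding expected_util_def deviation_util_def by simp
  then show ?thesis
    using deviation_util_eq[OF assms(1-3)] win_measure_self[OF assms(3,4)] by simp
qed

section \<open>Integrals over the unit interval\<close>

lemma integrable_unit_interval_bounded:
  fixes f :: "real \<Rightarrow> real"
  assumes "f \<in> borel_measurable unit_interval" "\<And>t. t \<in> {0..1} \<Longrightarrow> \<bar>f t\<bar> \<le> C"
  shows "integrable unit_interval f"
proof -
  interpret prob_space unit_interval by (rule prob_space_unit_interval)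
  show ?thesis
    using assms by (intro integrable_const_bound[of _ C] AE_I2) auto
qed

lemma bounded_on_unit_interval:
  fixes g :: "real \<Rightarrow> real"
  assumes "continuous_on {0..1} g"
  obtains C where "\<And>t. t \<in> {0..1} \<Longrightarrow> \<bar>g t\<bar> \<le> C"
proof -
  have "bounded (g ` {0..1})"
    by (intro compact_imp_bounded compact_continuous_image assms) simp
  then obtain C where "\<forall>t\<in>{0..1}. \<bar>g t\<bar> \<le> C"
    by (auto simp: bounded_iff)
  then show ?thesis
    using that by blast
qed

lemma integrable_unit_interval_continuous:
  fixes f :: "real \<Rightarrow> real"
  assumes "continuous_on {0..1} f"
  shows "integrable unit_interval f"
proof -
  obtain C where "\<And>t. t \<in> {0..1} \<Longrightarrow> \<bar>f t\<bar> \<le> C"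
    by (rule bounded_on_unit_interval[OF assms]) blast
  then show ?thesis
    by (rule integrable_unit_interval_bounded[OF
        continuous_on_borel_measurable_unit_interval[OF assms]])
qed

text \<open>The fundamental theorem of calculus for an integrand cut off outside
  \<open>{a..b}\<close>, so that factors such as \<open>of_bool (s \<le> c)\<close> turn into limits
  of integration.\<close>

lemma integral_unit_interval_Icc:
  fixes F f :: "real \<Rightarrow> real"
  assumes "0 \<le> a" "a \<le> b" "b \<le> 1" and h: "\<And>t. t \<in> {a..b} \<Longrightarrow> h t = f t"
    and h0: "\<And>t. t \<in> {0..1} - {a..b} \<Longrightarrow> h t = 0"
    and F: "\<And>t. t \<in> {0..1} \<Longrightarrow> (F has_real_derivative f t) (at t within {0..1})"
    and f: "continuous_on {0..1} f"
  shows "(LINT t|unit_interval. h t) = F b - F a"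
proof -
  have "(LINT t|unit_interval. h t) = (LINT t|lborel. indicator {a..b} t *\<^sub>R f t)"
    unfolding integral_unit_interval
  proof (rule Bochner_Integration.integral_cong)
    fix t :: real
    show "indicator {0..1} t *\<^sub>R h t = indicator {a..b} t *\<^sub>R f t"
      using h[of t] h0[of t] \<open>0 \<le> a\<close> \<open>b \<le> 1\<close>
      by (cases "t \<in> {0..1}"; cases "t \<in> {a..b}") auto
  qed simp
  also have "\<dots> = F b - F a"
  proof (rule integral_FTC_atLeastAtMost)
    fix t assume "a \<le> t" "t \<le> b"
    then show "(F has_vector_derivative f t) (at t within {a..b})"
      using F[of t] \<open>0 \<le> a\<close> \<open>b \<le> 1\<close>
        has_vector_derivative_within_subset[of F "f t" t "{0..1}" "{a..b}"]
      by (simp add: has_real_derivative_iff_has_vector_derivative)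
  next
    show "continuous_on {a..b} f"
      using \<open>0 \<le> a\<close> \<open>b \<le> 1\<close> by (intro continuous_on_subset[OF f]) auto
  qed (rule \<open>a \<le> b\<close>)
  finally show ?thesis .
qed

section \<open>Powers of the winning probability as integrals, and the exchange of
  integration\<close>

lemma measure_unit_interval_Icc:
  "c \<in> {0..1} \<Longrightarrow> measure unit_interval {0..c} = c" "c \<in> {0..1} \<Longrightarrow> measure unit_interval {0..<c} = c"
  by (simp_all add: measure_restrict_space atLeastLessThan_subseteq_atLeastAtMost_iff)

text \<open>Monotonicity is what makes \<open>win_measure f\<close> a Borel function of the
  bid.\<close>

lemma mono_win_measure:
  assumes "strict_mono_on {0..1} f"
  shows "mono (win_measure f)"
proof (rule monoI)
  interpret prob_space unit_interval by (rule prob_space_unit_interval)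
  fix x y :: real assume "x \<le> y"
  then show "win_measure f x \<le> win_measure f y"
    unfolding win_measure_def
    by (intro finite_measure_mono sets_unit_interval_less strict_mono_on_borel_measurable_unit_interval assms) auto
qed

text \<open>With \<open>c = win_measure f b\<close>, the set {f < b} is the initial segment [0,c) up
  to the point \<open>c\<close>, and \<open>n * s ^ (n - 1)\<close> integrates over it to
  \<open>c ^ n\<close>. The power thus becomes linear in the indicator of {f < b}, ready for
  Fubini.\<close>

lemma win_measure_power:
  assumes f: "strict_mono_on {0..1} f" and n: "n \<ge> 1"
  shows "win_measure f b ^ n = (LINT s|unit_interval. real n * s ^ (n - 1) * of_bool (f s < b))"
proof -
  interpret prob_space unit_interval by (rule prob_space_unit_interval)
  have fm[measurable]: "f \<in> borel_measurable unit_interval"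
    by (rule strict_mono_on_borel_measurable_unit_interval[OF f])
  have [measurable]: "(\<lambda>s::real. s) \<in> borel_measurable unit_interval"
    by (rule continuous_on_borel_measurable_unit_interval) (rule continuous_on_id)
  define c where "c = win_measure f b"
  have c: "0 \<le> c" "c \<le> 1"
    by (simp_all add: c_def win_measure_nonneg win_measure_le_1)
  \<comment> \<open>Otherwise monotonicity confines {f < b} to [0,s), whose measure \<open>s\<close>
    is smaller than \<open>c\<close>.\<close>
  have below: "f s < b" if "s \<in> {0..1}" "s < c" for s
  proof (rule ccontr)
    assume "\<not> f s < b"
    then have "{s \<in> {0..1}. f s < b} \<subseteq> {0..<s}"
      using that strict_mono_on_leD[OF f that(1)] by force
    then have "c \<le> measure unit_interval {0..<s}"
      unfolding c_def win_measure_def using that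
      by (intro finite_measure_mono sets_unit_interval) auto
    then show False
      using that by (simp add: measure_unit_interval_Icc)
  qed
  \<comment> \<open>Otherwise {f < b} contains [0,s], whose measure \<open>s\<close> exceeds
    \<open>c\<close>.\<close>
  have above: "\<not> f s < b" if "s \<in> {0..1}" "c < s" for s
  proof
    assume "f s < b"
    have "f r < b" if "r \<in> {0..s}" for r
      using strict_mono_on_leD[OF f, of r s] that \<open>s \<in> {0..1}\<close> \<open>f s < b\<close> by simp
    then have "{0..s} \<subseteq> {s \<in> {0..1}. f s < b}"
      using that by auto
    then have "measure unit_interval {0..s} \<le> c"
      unfolding c_def win_measure_def by (intro finite_measure_mono sets_unit_interval_less fm)
    then show False
      using that by (simp add: measure_unit_interval_Icc)
  qed
  have "(LINT s|unit_interval. real n * s ^ (n - 1) * of_bool (f s < b)) =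
      (LINT s|unit_interval. real n * s ^ (n - 1) * of_bool (s \<le> c))"
  proof (rule integral_cong_AE)
    show "AE s in unit_interval. real n * s ^ (n - 1) * of_bool (f s < b) =
        real n * s ^ (n - 1) * of_bool (s \<le> c)"
      using AE_unit_interval_neq[of c]
    proof eventually_elim
      case (elim s)
      then show ?case
        using above[of s] below[of s] by (cases "s < c") auto
    qed
  qed measurable
  also have "\<dots> = c ^ n - 0 ^ n"
  proof (rule integral_unit_interval_Icc[where f = "\<lambda>s. real n * s ^ (n - 1)"
        and F = "\<lambda>s. s ^ n" and a = 0 and b = c])
    show "((\<lambda>s. s ^ n) has_real_derivative real n * t ^ (n - 1)) (at t within {0..1})" for t :: real
      by (rule derivative_eq_intros refl)+ simp
    show "continuous_on {0..1} (\<lambda>s. real n * s ^ (n - 1))"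
      by (intro continuous_intros)
  qed (use c in auto)
  finally show ?thesis
    using n by (simp add: c_def)
qed

text \<open>The integrand without its indicator has the antiderivative
  \<open>- (\<beta> 1 - \<beta> t)\<^sup>2 / 2\<close>, and the indicator restricts it to the types
  above the solution \<open>t0\<close> of \<open>\<beta> t0 = y\<close>. The maximum covers
  thresholds from \<open>\<beta> 1\<close> upwards, which leave nothing to integrate.\<close>

lemma integral_above_threshold:
  fixes \<beta> \<beta>' :: "real \<Rightarrow> real"
  assumes deriv: "\<And>t. t \<in> {0..1} \<Longrightarrow> (\<beta> has_real_derivative \<beta>' t) (at t within {0..1})"
    and cont: "continuous_on {0..1} \<beta>'" and mono: "strict_mono_on {0..1} \<beta>"
    and y: "\<beta> 0 \<le> y"
  shows "(LINT t|unit_interval. \<beta>' t * (\<beta> 1 - \<beta> t) * of_bool (y < \<beta> t)) = (max 0 (\<beta> 1 - y))\<^sup>2 / 2"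
proof -
  have \<beta>c: "continuous_on {0..1} \<beta>"
    by (rule DERIV_continuous_on[OF deriv])
  show ?thesis
  proof (cases "y < \<beta> 1")
    case False
    have "(LINT t|unit_interval. \<beta>' t * (\<beta> 1 - \<beta> t) * of_bool (y < \<beta> t)) = (LINT t|unit_interval. 0)"
    proof (rule Bochner_Integration.integral_cong)
      fix t assume "t \<in> space unit_interval"
      then have "\<beta> t \<le> \<beta> 1"
        using strict_mono_on_leD[OF mono, of t 1] by simp
      then show "\<beta>' t * (\<beta> 1 - \<beta> t) * of_bool (y < \<beta> t) = 0"
        using False by simp
    qed simp
    then show ?thesis using False by simp
  next
    case True
    then obtain t0 where t0: "t0 \<in> {0..1}" "\<beta> t0 = y"
      using IVT'[of \<beta> 0 y 1] y \<beta>c by auto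
    have iff: "y < \<beta> t \<longleftrightarrow> t0 < t" if "t \<in> {0..1}" for t
      using strict_mono_on_less[OF mono, of t0 t] t0 that by auto
    have "(LINT t|unit_interval. \<beta>' t * (\<beta> 1 - \<beta> t) * of_bool (y < \<beta> t)) =
        (LINT t|unit_interval. \<beta>' t * (\<beta> 1 - \<beta> t) * of_bool (t0 \<le> t))"
    proof (rule integral_cong_AE)
      have [measurable]: "\<beta> \<in> borel_measurable unit_interval" "\<beta>' \<in> borel_measurable unit_interval"
          "(\<lambda>t::real. t) \<in> borel_measurable unit_interval"
        by (intro continuous_on_borel_measurable_unit_interval \<beta>c cont continuous_on_id)+
      show "(\<lambda>t. \<beta>' t * (\<beta> 1 - \<beta> t) * of_bool (y < \<beta> t)) \<in> borel_measurable unit_interval"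
        "(\<lambda>t. \<beta>' t * (\<beta> 1 - \<beta> t) * of_bool (t0 \<le> t)) \<in> borel_measurable unit_interval"
        by measurable
      show "AE t in unit_interval. \<beta>' t * (\<beta> 1 - \<beta> t) * of_bool (y < \<beta> t) =
          \<beta>' t * (\<beta> 1 - \<beta> t) * of_bool (t0 \<le> t)"
        using AE_unit_interval_neq[of t0] by eventually_elim (use iff in auto)
    qed
    also have "\<dots> = - (\<beta> 1 - \<beta> 1)\<^sup>2 / 2 - (- (\<beta> 1 - \<beta> t0)\<^sup>2 / 2)"
      by (rule integral_unit_interval_Icc[where f = "\<lambda>t. \<beta>' t * (\<beta> 1 - \<beta> t)"
            and F = "\<lambda>t. - (\<beta> 1 - \<beta> t)\<^sup>2 / 2"])
        (use t0 in \<open>auto intro!: derivative_eq_intros deriv continuous_intros cont \<beta>c\<close>)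
    finally show ?thesis
      using t0 True by simp
  qed
qed

text \<open>\<open>win_measure_power\<close> gives a double integral over \<open>t\<close> and a
  rival variable \<open>s\<close>. After the exchange, the inner integral runs over the
  \<open>t\<close> with \<open>f s < \<beta> t\<close>, which is
  \<open>integral_above_threshold\<close> at \<open>y = f s\<close>.\<close>

lemma integral_win_measure_power:
  fixes \<beta> \<beta>' f :: "real \<Rightarrow> real"
  assumes deriv: "\<And>t. t \<in> {0..1} \<Longrightarrow> (\<beta> has_real_derivative \<beta>' t) (at t within {0..1})"
    and cont: "continuous_on {0..1} \<beta>'" and mono: "strict_mono_on {0..1} \<beta>"
    and f: "strict_mono_on {0..1} f" and f0: "\<And>s. s \<in> {0..1} \<Longrightarrow> \<beta> 0 \<le> f s" and n: "n \<ge> 1"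
  shows "(LINT t|unit_interval. \<beta>' t * (\<beta> 1 - \<beta> t) * win_measure f (\<beta> t) ^ n) =
    (LINT s|unit_interval. real n * s ^ (n - 1) * ((max 0 (\<beta> 1 - f s))\<^sup>2 / 2))"
proof -
  interpret U: prob_space unit_interval by (rule prob_space_unit_interval)
  interpret P: pair_prob_space unit_interval unit_interval ..
  have \<beta>c: "continuous_on {0..1} \<beta>"
    by (rule DERIV_continuous_on[OF deriv])
  have [measurable]: "\<beta> \<in> borel_measurable unit_interval" "\<beta>' \<in> borel_measurable unit_interval"
      "(\<lambda>t::real. t) \<in> borel_measurable unit_interval" "f \<in> borel_measurable unit_interval"
    by (intro continuous_on_borel_measurable_unit_interval \<beta>c cont continuous_on_id
        strict_mono_on_borel_measurable_unit_interval f)+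
  let ?k = "\<lambda>s t. real n * s ^ (n - 1) * (\<beta>' t * (\<beta> 1 - \<beta> t) * of_bool (f s < \<beta> t))"
  obtain C where C: "\<And>t. t \<in> {0..1} \<Longrightarrow> \<bar>\<beta>' t * (\<beta> 1 - \<beta> t)\<bar> \<le> C"
    by (rule bounded_on_unit_interval[of "\<lambda>t. \<beta>' t * (\<beta> 1 - \<beta> t)"])
      (auto intro!: continuous_intros cont \<beta>c)
  \<comment> \<open>The kernel is bounded on a product of probability spaces, so Fubini
    applies.\<close>
  have "integrable (unit_interval \<Otimes>\<^sub>M unit_interval) (case_prod ?k)"
  proof (rule P.integrable_const_bound[of _ "real n * C"])
    have bound: "\<bar>?k s t\<bar> \<le> real n * C" if "s \<in> {0..1}" "t \<in> {0..1}" for s t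
    proof -
      have "\<bar>?k s t\<bar> = real n * s ^ (n - 1) * (\<bar>\<beta>' t * (\<beta> 1 - \<beta> t)\<bar> * of_bool (f s < \<beta> t))"
        using that by (simp add: abs_mult)
      also have "\<dots> \<le> real n * 1 * (C * 1)"
        using that C[of t] by (intro mult_mono power_le_one mult_nonneg_nonneg) auto
      finally show ?thesis by simp
    qed
    show "AE x in unit_interval \<Otimes>\<^sub>M unit_interval. norm (case_prod ?k x) \<le> real n * C"
      using bound by (intro AE_I2) (auto simp: space_pair_measure)
  qed measurable
  note F = P.Fubini_integral[OF this]
  have "\<beta>' t * (\<beta> 1 - \<beta> t) * win_measure f (\<beta> t) ^ n = (LINT s|unit_interval. ?k s t)" for t
    unfolding win_measure_power[OF f n]
    by (subst integral_mult_right_zero[symmetric]) (simp only: mult_ac)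
  then have "(LINT t|unit_interval. \<beta>' t * (\<beta> 1 - \<beta> t) * win_measure f (\<beta> t) ^ n) =
      (LINT t|unit_interval. LINT s|unit_interval. ?k s t)"
    by simp
  also have "\<dots> = (LINT s|unit_interval. LINT t|unit_interval. ?k s t)"
    by (rule F)
  also have "\<dots> = (LINT s|unit_interval. real n * s ^ (n - 1) * ((max 0 (\<beta> 1 - f s))\<^sup>2 / 2))"
  proof (rule Bochner_Integration.integral_cong)
    fix s assume "s \<in> space unit_interval"
    then show "(LINT t|unit_interval. ?k s t) = real n * s ^ (n - 1) * ((max 0 (\<beta> 1 - f s))\<^sup>2 / 2)"
      using integral_above_threshold[OF deriv cont mono f0[of s]] by simp
  qed simp
  finally show ?thesis .
qed

section \<open>The dual constraint\<close>

text \<open>The bid is a Lebesgue integral, while the fundamental theorem is applied to the gauge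
  integral; both agree because the integrand is continuous.\<close>

lemma canonical_bid_has_real_derivative:
  assumes N: "N \<ge> 2" and v: "continuous_on {0..1} v" and t: "t \<in> {0..1}"
  shows "(canonical_bid N v has_real_derivative real (N - 1) * t ^ (N - 2) * v t) (at t within {0..1})"
proof (rule has_field_derivative_transform_within[OF _ zero_less_one t])
  let ?g = "\<lambda>s. real (N - 1) * s ^ (N - 2) * v s"
  have g: "continuous_on {0..1} ?g"
    by (intro continuous_intros v)
  show "((\<lambda>x. integral {0..x} ?g) has_real_derivative ?g t) (at t within {0..1})"
    by (rule integral_has_real_derivative[OF g t])
  fix x :: real assume "x \<in> {0..1}"
  then have "set_integrable lborel {0..x} ?g"
    by (intro borel_integrable_atLeastAtMost' continuous_on_subset[OF g]) auto
  then show "integral {0..x} ?g = canonical_bid N v x"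
    using N by (simp add: canonical_bid_def set_borel_integral_eq_integral(2) of_nat_diff)
qed

lemma canonical_bid_0 [simp]: "canonical_bid N v 0 = 0"
proof -
  have "set_integrable lborel {0..0} (\<lambda>s. (real N - 1) * s ^ (N - 2) * v s)"
    by (rule borel_integrable_atLeastAtMost') simp
  from set_borel_integral_eq_integral(2)[OF this] show ?thesis
    by (simp add: canonical_bid_def)
qed

text \<open>Put a = \<beta>(1) - \<beta>(t) and d = l(t) - \<beta>(t). If d \<le> a, then (a -
  d)^2/2 - a^2/2 + a d = d^2/2. If d > a, the maximum is 0 and a d - a^2/2 = a^2/2 + a (d - a). The
  form without cases shows continuity and separates the term that the exchange of integration
  produces.\<close>

lemma alpha_eq:
  "alpha N v i l t = t ^ (N - 2) *
    ((max 0 (canonical_bid N v 1 - l i t))\<^sup>2 / 2 - (canonical_bid N v 1 - canonical_bid N v t)\<^sup>2 / 2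
      + (canonical_bid N v 1 - canonical_bid N v t) * (l i t - canonical_bid N v t))"
  unfolding alpha_def Let_def by (auto simp: max_def field_simps power2_eq_square)

lemma alpha_nonneg:
  assumes "0 \<le> t" "canonical_bid N v t \<le> canonical_bid N v 1"
  shows "0 \<le> alpha N v i l t"
  using assms unfolding alpha_def Let_def by auto

text \<open>The integrand of the dual constraint at the proposed \<epsilon>, with both utilities in
  closed form. It depends on the common strategy alone and contains no integral over the vector of
  rival types.\<close>

definition regret_density :: "nat \<Rightarrow> (real \<Rightarrow> real) \<Rightarrow> (real \<Rightarrow> real) \<Rightarrow> real \<Rightarrow> real" where
  "regret_density N v f t =
    (let \<beta> = canonical_bid N v in t ^ (N - 2) * (\<beta> 1 - \<beta> t) *
      ((win_measure f (\<beta> t) ^ (N - 1) * v t - \<beta> t) - (t ^ (N - 1) * v t - f t)))"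

lemma regret_density_eq:
  assumes "i \<in> {1..N}" "\<forall>j\<in>{1..N}. l j = l i" "strict_mono_on {0..1} (l i)" "t \<in> {0..1}"
  shows "t ^ (N - 2) * (canonical_bid N v 1 - canonical_bid N v t) *
      (deviation_util N v i (canonical_bid N v t) l t - expected_util N v i l t) =
    regret_density N v (l i) t"
  unfolding regret_density_def Let_def deviation_util_eq[OF assms(1-3)] expected_util_eq[OF assms] ..

text \<open>Scaled by \<open>N - 1\<close>, the regret density is \<open>w f - w \<beta> + k\<close>
  and \<open>alpha\<close> is \<open>q f - q \<beta> + k\<close>, with the same \<open>k\<close>.
  Exchanging integrals shows that \<open>w\<close> and \<open>q\<close> have equal integrals, both
  for \<open>f\<close> and for \<beta>; the positive factor then cancels.\<close>

lemma integral_regret_density: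
  assumes N: "N \<ge> 2" and v: "continuous_on {0..1} v"
    and mono: "strict_mono_on {0..1} (canonical_bid N v)"
    and f: "strict_mono_on {0..1} (l i)" and fc: "continuous_on {0..1} (l i)"
    and f0: "\<And>s. s \<in> {0..1} \<Longrightarrow> canonical_bid N v 0 \<le> l i s"
  shows "integrable unit_interval (regret_density N v (l i))"
    and "integrable unit_interval (alpha N v i l)"
    and "(LINT t|unit_interval. regret_density N v (l i) t) = (LINT t|unit_interval. alpha N v i l t)"
proof -
  let ?\<beta> = "canonical_bid N v" and ?f = "l i"
  define \<beta>' where "\<beta>' = (\<lambda>t. real (N - 1) * t ^ (N - 2) * v t)"
  \<comment> \<open>\<open>w\<close> carries the gains from winning, \<open>k\<close> the difference
    in payments, and \<open>q\<close> is what \<open>w\<close> becomes after the exchange. The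
    factor \<open>N - 1\<close> completes \<open>t ^ (N - 2) * v t\<close> to the derivative of
    \<beta>.\<close>
  define w where "w f t = \<beta>' t * (?\<beta> 1 - ?\<beta> t) * win_measure f (?\<beta> t) ^ (N - 1)" for f t
  define k where "k t = real (N - 1) * (t ^ (N - 2) * ((?\<beta> 1 - ?\<beta> t) * (?f t - ?\<beta> t)))" for t
  define q where "q f t = real (N - 1) * t ^ (N - 2) * ((max 0 (?\<beta> 1 - f t))\<^sup>2 / 2)" for f t
  have deriv: "(?\<beta> has_real_derivative \<beta>' t) (at t within {0..1})" if "t \<in> {0..1}" for t
    unfolding \<beta>'_def by (rule canonical_bid_has_real_derivative[OF N v that])
  have \<beta>c: "continuous_on {0..1} ?\<beta>"
    by (rule DERIV_continuous_on[OF deriv])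
  have \<beta>'c: "continuous_on {0..1} \<beta>'"
    unfolding \<beta>'_def by (intro continuous_intros v)
  have n: "N - 1 \<ge> 1" and n2: "N - 1 - 1 = N - 2"
    using N by simp_all
  have w_int: "integrable unit_interval (w f)" if f: "strict_mono_on {0..1} f" for f
  proof -
    obtain C where C: "\<And>t. t \<in> {0..1} \<Longrightarrow> \<bar>\<beta>' t * (?\<beta> 1 - ?\<beta> t)\<bar> \<le> C"
      by (rule bounded_on_unit_interval[of "\<lambda>t. \<beta>' t * (?\<beta> 1 - ?\<beta> t)"])
        (auto intro!: continuous_intros \<beta>'c \<beta>c)
    have [measurable]: "?\<beta> \<in> borel_measurable unit_interval" "\<beta>' \<in> borel_measurable unit_interval"
        "win_measure f \<in> borel_measurable borel"
      by (intro continuous_on_borel_measurable_unit_interval \<beta>c \<beta>'c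
          borel_measurable_mono mono_win_measure f)+
    show ?thesis
    proof (rule integrable_unit_interval_bounded)
      show "w f \<in> borel_measurable unit_interval"
        unfolding w_def by measurable
      fix t :: real assume t: "t \<in> {0..1}"
      have "\<bar>w f t\<bar> = \<bar>\<beta>' t * (?\<beta> 1 - ?\<beta> t)\<bar> * win_measure f (?\<beta> t) ^ (N - 1)"
        by (simp add: w_def abs_mult win_measure_nonneg)
      also have "\<dots> \<le> C * 1"
        using C[OF t] by (intro mult_mono power_le_one)
          (auto simp: win_measure_nonneg win_measure_le_1)
      finally show "\<bar>w f t\<bar> \<le> C" by simp
    qed
  qed
  have q_int: "integrable unit_interval (q f)" if "continuous_on {0..1} f" for f
    unfolding q_def by (intro integrable_unit_interval_continuous continuous_intros that) simp
  have k_int: "integrable unit_interval k"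
    unfolding k_def by (intro integrable_unit_interval_continuous continuous_intros \<beta>c fc)
  have wq: "(LINT t|unit_interval. w f t) = (LINT t|unit_interval. q f t)"
    if "strict_mono_on {0..1} f" "\<And>s. s \<in> {0..1} \<Longrightarrow> ?\<beta> 0 \<le> f s" for f
    unfolding w_def q_def using integral_win_measure_power[OF deriv \<beta>'c mono that n] n2 by simp
  have \<beta>0: "?\<beta> 0 \<le> ?\<beta> s" if "s \<in> {0..1}" for s
    using strict_mono_on_leD[OF mono, of 0 s] that by simp
  \<comment> \<open>Under any increasing symmetric profile type \<open>t\<close> wins with
    probability \<open>t ^ (N - 1)\<close>, which is also the winning probability of
    \<open>\<beta> t\<close> against \<beta>. Hence the utility of following the profile enters as
    \<open>w \<beta>\<close>, whatever \<open>f\<close> is.\<close>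
  have regret: "real (N - 1) * regret_density N v ?f t = w ?f t - w ?\<beta> t + k t" if "t \<in> {0..1}" for t
    unfolding w_def k_def regret_density_def Let_def \<beta>'_def win_measure_self[OF mono that]
    by (simp add: algebra_simps)
  \<comment> \<open>As \<open>\<beta> t \<le> \<beta> 1\<close>, the maximum in
    \<open>q \<beta> t\<close> drops out, leaving the square subtracted in
    \<open>alpha_eq\<close>.\<close>
  have alpha: "real (N - 1) * alpha N v i l t = q ?f t - q ?\<beta> t + k t" if "t \<in> {0..1}" for t
    using strict_mono_on_leD[OF mono, of t 1] that
    unfolding q_def k_def alpha_eq by (simp add: algebra_simps)
  have "integrable unit_interval (\<lambda>t. w ?f t - w ?\<beta> t + k t)"
    by (intro Bochner_Integration.integrable_add Bochner_Integration.integrable_diff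
        w_int f mono k_int)
  then have ir: "integrable unit_interval (\<lambda>t. real (N - 1) * regret_density N v ?f t)"
    by (rule Bochner_Integration.integrable_cong[THEN iffD1, rotated 2]) (simp_all del: One_nat_def add: regret)
  then show "integrable unit_interval (regret_density N v ?f)"
    using N by simp
  have "integrable unit_interval (\<lambda>t. q ?f t - q ?\<beta> t + k t)"
    by (intro Bochner_Integration.integrable_add Bochner_Integration.integrable_diff
        q_int fc \<beta>c k_int)
  then have ia: "integrable unit_interval (\<lambda>t. real (N - 1) * alpha N v i l t)"
    by (rule Bochner_Integration.integrable_cong[THEN iffD1, rotated 2]) (simp_all del: One_nat_def add: alpha)
  then show "integrable unit_interval (alpha N v i l)"
    using N by simp
  have "real (N - 1) * (LINT t|unit_interval. regret_density N v ?f t) =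
      (LINT t|unit_interval. real (N - 1) * regret_density N v ?f t)"
    by simp
  also have "\<dots> = (LINT t|unit_interval. w ?f t - w ?\<beta> t + k t)"
    by (rule Bochner_Integration.integral_cong) (simp_all del: One_nat_def add: regret)
  also have "\<dots> = (LINT t|unit_interval. w ?f t) - (LINT t|unit_interval. w ?\<beta> t)
      + (LINT t|unit_interval. k t)"
    by (simp add: w_int f mono k_int)
  also have "\<dots> = (LINT t|unit_interval. q ?f t) - (LINT t|unit_interval. q ?\<beta> t)
      + (LINT t|unit_interval. k t)"
    by (simp only: wq[OF f f0] wq[OF mono \<beta>0])
  also have "\<dots> = (LINT t|unit_interval. q ?f t - q ?\<beta> t + k t)"
    by (simp add: q_int fc \<beta>c k_int)
  also have "\<dots> = (LINT t|unit_interval. real (N - 1) * alpha N v i l t)"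
    by (rule Bochner_Integration.integral_cong) (simp_all del: One_nat_def add: alpha)
  also have "\<dots> = real (N - 1) * (LINT t|unit_interval. alpha N v i l t)"
    by simp
  finally show "(LINT t|unit_interval. regret_density N v (l i) t) =
      (LINT t|unit_interval. alpha N v i l t)"
    using N by simp
qed

text \<open>Serves to reach the endpoints, where \<open>alpha\<close> may vanish without determining
  the bid: at 0 because of \<open>t ^ (N - 2)\<close> when \<open>N > 2\<close>, at 1 because the
  branch for bids above \<open>\<beta> 1\<close> is 0 there.\<close>

lemma continuous_on_eq_Icc_if_eq_Ioo:
  fixes f g :: "real \<Rightarrow> real"
  assumes "continuous_on {0..1} f" "continuous_on {0..1} g"
    and "\<And>t. t \<in> {0<..<1} \<Longrightarrow> f t = g t" and t: "t \<in> {0..1}"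
  shows "f t = g t"
proof -
  have "(\<lambda>t. f t - g t) t = 0"
    by (rule continuous_constant_on_closure[of "{0<..<1}"]) (use assms in \<open>auto intro: continuous_intros\<close>)
  then show ?thesis by simp
qed

text \<open>A nonnegative continuous function with integral 0 vanishes identically. In the open
  interval the factor \<open>t ^ (N - 2)\<close> is positive, so the other factor of
  \<open>alpha\<close> vanishes, which happens only at the canonical bid.\<close>

lemma eq_canonical_bid_if_integral_alpha_eq_0:
  assumes N: "N \<ge> 2" and v: "continuous_on {0..1} v"
    and mono: "strict_mono_on {0..1} (canonical_bid N v)"
    and fc: "continuous_on {0..1} (l i)"
    and zero: "(LINT t|unit_interval. alpha N v i l t) = 0" and t: "t \<in> {0..1}"
  shows "l i t = canonical_bid N v t"
proof -
  let ?\<beta> = "canonical_bid N v"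
  have \<beta>c: "continuous_on {0..1} ?\<beta>"
    by (rule DERIV_continuous_on[OF canonical_bid_has_real_derivative[OF N v]])
  have ac: "continuous_on {0..1} (alpha N v i l)"
    unfolding alpha_eq by (intro continuous_intros \<beta>c fc) simp_all
  have "set_integrable lborel {0..1} (alpha N v i l)"
    by (rule borel_integrable_atLeastAtMost'[OF ac])
  note si = set_borel_integral_eq_integral[OF this]
  have "(LINT t|unit_interval. alpha N v i l t) = integral {0..1} (alpha N v i l)"
    unfolding integral_unit_interval using si(2) by (simp add: set_lebesgue_integral_def)
  then have hi: "(alpha N v i l has_integral 0) (cbox 0 1)"
    using si(1) zero by (simp add: has_integral_iff)
  have "alpha N v i l s = 0" if "s \<in> {0..1}" for s
  proof (rule has_integral_0_cbox_imp_0[OF _ _ hi])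
    show "0 \<le> alpha N v i l x" if "x \<in> box 0 1" for x
      using that strict_mono_on_leD[OF mono, of x 1] by (intro alpha_nonneg) (auto simp: box_real)
  qed (use ac that in auto)
  then have "l i s = ?\<beta> s" if "s \<in> {0<..<1}" for s
  proof -
    have lt: "?\<beta> s < ?\<beta> 1"
      using strict_mono_onD[OF mono, of s 1] that by simp
    have a: "alpha N v i l s = 0"
      using \<open>\<And>s. s \<in> {0..1} \<Longrightarrow> alpha N v i l s = 0\<close> that by simp
    \<comment> \<open>This rules out the branch for high bids; the other branch is half the squared
      distance from the canonical bid.\<close>
    have "0 < (?\<beta> 1 - ?\<beta> s)\<^sup>2 / 2 + (?\<beta> 1 - ?\<beta> s) * (l i s - ?\<beta> 1)" if "l i s > ?\<beta> 1"
      using lt that by (intro add_pos_pos mult_pos_pos) auto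
    then show ?thesis
      using a that unfolding alpha_def Let_def by (auto split: if_splits)
  qed
  then show ?thesis
    by (rule continuous_on_eq_Icc_if_eq_Ioo[OF fc \<beta>c _ t])
qed

section \<open>Measurability on the space of profiles\<close>

lemma bid_profiles_component:
  "l \<in> bid_profiles N B \<Longrightarrow> i \<in> {1..N} \<Longrightarrow> l i \<in> {0..1} \<rightarrow>\<^sub>E B"
  unfolding bid_profiles_def by (rule PiE_mem)

text \<open>Values at one point differ by at most the sup distance, so evaluation is
  1-Lipschitz.\<close>

lemma continuous_map_funspace_eval:
  assumes "x \<in> S"
  shows "continuous_map (mtopology_of (funspace S m)) (mtopology_of m) (\<lambda>f. f x)"
proof (rule Lipschitz_continuous_imp_continuous_map)
  have "mdist m (f x) (g x) \<le> 1 * mdist (funspace S m) f g"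
    if "f \<in> mspace (funspace S m)" "g \<in> mspace (funspace S m)" for f g
    using funspace_mdist_le[OF that, of "mdist (funspace S m) f g"] assms by auto
  moreover have "(\<lambda>f. f x) \<in> mspace (funspace S m) \<rightarrow> mspace m"
    using funspace_imp_welldefined[OF _ assms] by blast
  ultimately show "Lipschitz_continuous_map (funspace S m) m (\<lambda>f. f x)"
    unfolding Lipschitz_continuous_map_def by blast
qed

text \<open>Points of these function spaces are bounded functions. Each strategy is bounded because
  \<open>B\<close> is, and the map from buyers to strategies because there are finitely many buyers.
  Hence a set of bidding profiles is the full carrier of its subspace topology.\<close>

lemma bid_profiles_subset_topspace:
  assumes "bounded B"
  shows "bid_profiles N B \<subseteq> topspace (sup_norm_topology N)"
proof
  fix l assume l: "l \<in> bid_profiles N B"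
  have li: "l i \<in> mspace (funspace {0..1} euclidean_metric)" if "i \<in> {1..N}" for i
  proof -
    have "l i \<in> {0..1} \<rightarrow>\<^sub>E B"
      by (rule bid_profiles_component[OF l that])
    moreover have "bounded (l i ` {0..1})"
      by (rule bounded_subset[OF assms]) (use calculation in auto)
    ultimately show ?thesis
      by (auto simp: Metric_space.fspace_def[OF Met_TC.Metric_space_axioms] PiE_def)
  qed
  interpret Metric_space "mspace (funspace {0..1::real} (euclidean_metric :: real metric))"
      "mdist (funspace {0..1::real} (euclidean_metric :: real metric))"
    by (rule Metric_space_mspace_mdist)
  have "l ` {1..N} \<subseteq> mspace (funspace {0..1} euclidean_metric)"
    using li by blast
  moreover from this have "mbounded (l ` {1..N})"
    by (intro compactin_imp_mbounded finite_imp_compactin) (simp_all only: topspace_mtopology finite_imageI finite_atLeastAtMost)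
  ultimately have "l \<in> fspace {1..N}"
    unfolding fspace_def using l by (simp add: bid_profiles_def PiE_def del: mspace_funspace mdist_funspace)
  then show "l \<in> topspace (sup_norm_topology N)"
    unfolding sup_norm_topology_def topspace_mtopology_of by (subst mspace_funspace)
qed

text \<open>Evaluation at \<open>i\<close> followed by evaluation at \<open>t\<close> is continuous,
  so preimages of open sets are generators of the Borel sets of \<open>\<Lambda>\<close>.\<close>

lemma borel_measurable_eval:
  assumes \<sigma>: "borel_prob_on N \<Lambda> \<sigma>" and \<Lambda>: "\<Lambda> \<subseteq> topspace (sup_norm_topology N)"
    and i: "i \<in> {1..N}" and t: "t \<in> {0..1}"
  shows "(\<lambda>l. l i t) \<in> borel_measurable \<sigma>"
proof (rule borel_measurableI)
  fix U :: "real set" assume U: "open U"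
  have "continuous_map (sup_norm_topology N) euclidean ((\<lambda>f. f t) \<circ> (\<lambda>l. l i))"
    unfolding sup_norm_topology_def mtopology_of_euclidean[symmetric]
    by (rule continuous_map_compose continuous_map_funspace_eval i t)+
  then have "continuous_map (subtopology (sup_norm_topology N) \<Lambda>) euclidean (\<lambda>l. l i t)"
    by (intro continuous_map_from_subtopology) (simp add: o_def)
  from openin_continuous_map_preimage[OF this, of U]
  have "openin (subtopology (sup_norm_topology N) \<Lambda>) {l \<in> \<Lambda>. l i t \<in> U}"
    using U \<Lambda> by (simp add: Int_absorb1)
  moreover have "{W. openin (subtopology (sup_norm_topology N) \<Lambda>) W} \<subseteq> Pow \<Lambda>"
    using openin_subset by fastforce
  ultimately have "{l \<in> \<Lambda>. l i t \<in> U} \<in> sets (borel_profiles N \<Lambda>)"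
    unfolding borel_profiles_def by (simp add: sigma_sets.Basic)
  then show "(\<lambda>l. l i t) -` U \<inter> space \<sigma> \<in> sets \<sigma>"
    using \<sigma> by (simp add: borel_prob_on_def vimage_def Int_def conj_commute)
qed

text \<open>The bid is measurable in the profile and continuous in the type. Rounding the type down
  to multiples of \<open>1 / Suc k\<close> leaves countably many cases, each measurable, and
  continuity gives the pointwise limit.\<close>

lemma borel_measurable_eval_pair:
  fixes \<sigma> :: "('i \<Rightarrow> real \<Rightarrow> real) measure" and i :: 'i
  assumes eval: "\<And>t. t \<in> {0..1} \<Longrightarrow> (\<lambda>l. l i t) \<in> borel_measurable \<sigma>"
    and cont: "\<And>l. l \<in> space \<sigma> \<Longrightarrow> continuous_on {0..1} (l i)"
  shows "(\<lambda>x. fst x i (snd x)) \<in> borel_measurable (\<sigma> \<Otimes>\<^sub>M unit_interval)"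
proof -
  \<comment> \<open>Clamping to the unit interval makes every integer \<open>z\<close> name an
    admissible type.\<close>
  define r :: "nat \<Rightarrow> int \<Rightarrow> real" where "r k z = max 0 (min 1 (of_int z / real (Suc k)))" for k z
  show ?thesis
  proof (rule borel_measurable_LIMSEQ_real)
    fix k
    have [measurable]: "(\<lambda>t::real. t) \<in> borel_measurable unit_interval"
      by (rule continuous_on_borel_measurable_unit_interval) (rule continuous_on_id)
    show "(\<lambda>x. fst x i (r k \<lfloor>snd x * real (Suc k)\<rfloor>)) \<in> borel_measurable (\<sigma> \<Otimes>\<^sub>M unit_interval)"
    proof (rule measurable_compose_countable[where f = "\<lambda>z x. fst x i (r k z)"])
      fix z
      have "(\<lambda>l. l i (r k z)) \<in> borel_measurable \<sigma>"
        by (rule eval) (simp add: r_def)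
      then show "(\<lambda>x. fst x i (r k z)) \<in> borel_measurable (\<sigma> \<Otimes>\<^sub>M unit_interval)"
        by (rule measurable_compose[OF measurable_fst])
    qed measurable
  next
    fix x assume "x \<in> space (\<sigma> \<Otimes>\<^sub>M unit_interval)"
    then have l: "continuous_on {0..1} (fst x i)" and t: "snd x \<in> {0..1}"
      by (auto simp: space_pair_measure cont)
    have "(\<lambda>k. real_of_int \<lfloor>snd x * real (Suc k)\<rfloor> / real (Suc k)) \<longlonglongrightarrow> snd x"
    proof (rule tendsto_sandwich)
      show "(\<lambda>k. snd x - inverse (real (Suc k))) \<longlonglongrightarrow> snd x"
        using tendsto_diff[OF tendsto_const LIMSEQ_inverse_real_of_nat, of "snd x"] by simp
      show "\<forall>\<^sub>F k in sequentially. snd x - inverse (real (Suc k)) \<le> \<lfloor>snd x * real (Suc k)\<rfloor> / real (Suc k)"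
      proof (rule always_eventually, rule allI)
        fix k
        have "snd x * real (Suc k) - 1 \<le> \<lfloor>snd x * real (Suc k)\<rfloor>"
          by linarith
        then show "snd x - inverse (real (Suc k)) \<le> \<lfloor>snd x * real (Suc k)\<rfloor> / real (Suc k)"
          using divide_right_mono[of "snd x * real (Suc k) - 1" "\<lfloor>snd x * real (Suc k)\<rfloor>" "real (Suc k)"]
          by (simp add: diff_divide_distrib inverse_eq_divide del: of_nat_Suc)
      qed
      show "\<forall>\<^sub>F k in sequentially. \<lfloor>snd x * real (Suc k)\<rfloor> / real (Suc k) \<le> snd x"
        by (rule always_eventually) (simp add: divide_le_eq del: of_nat_Suc)
    qed simp
    then have "(\<lambda>k. r k \<lfloor>snd x * real (Suc k)\<rfloor>) \<longlonglongrightarrow> max 0 (min 1 (snd x))"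
      unfolding r_def by (intro tendsto_intros)
    then show "(\<lambda>k. fst x i (r k \<lfloor>snd x * real (Suc k)\<rfloor>)) \<longlonglongrightarrow> fst x i (snd x)"
      using t by (intro continuous_on_tendsto_compose[OF l]) (auto simp: r_def)
  qed
qed

section \<open>Coarse correlated equilibria\<close>

text \<open>The weighted regret of one buyer is integrated over profiles and types in both orders.
  Profiles first, the equilibrium condition makes it at most 0; types first, it is an average of
  nonnegative integrals of \<open>alpha\<close>. So these vanish almost surely. By symmetry one
  buyer \<open>i\<close> suffices.\<close>

lemma measure_canonical_profile_BCCE:
  assumes N: "N \<ge> 2" and v: "continuous_on {0..1} v" and \<sigma>: "BCCE N v B \<Lambda> \<sigma>" and B: "bounded B"
    and B0: "\<forall>b\<in>B. 0 \<le> b"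
    and \<Lambda>: "\<Lambda> \<subseteq> bid_profiles N B" and can: "canonical_profile N v \<in> \<Lambda>"
    and sym: "\<And>l i j. l \<in> \<Lambda> \<Longrightarrow> i \<in> {1..N} \<Longrightarrow> j \<in> {1..N} \<Longrightarrow> l i = l j"
    and mono: "\<And>l i. l \<in> \<Lambda> \<Longrightarrow> i \<in> {1..N} \<Longrightarrow> strict_mono_on {0..1} (l i)"
    and cont: "\<And>l i. l \<in> \<Lambda> \<Longrightarrow> i \<in> {1..N} \<Longrightarrow> continuous_on {0..1} (l i)"
  shows "measure \<sigma> {canonical_profile N v} = 1"
proof -
  let ?\<beta> = "canonical_bid N v"
  obtain i where i: "i \<in> {1..N}"
    using N by (auto intro: that[of 1])
  have prob: "prob_space \<sigma>" and space: "space \<sigma> = \<Lambda>" and borel: "borel_prob_on N \<Lambda> \<sigma>"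
    using \<sigma> by (simp_all add: BCCE_def borel_prob_on_def)
  interpret S: prob_space \<sigma> by (rule prob)
  interpret U: prob_space unit_interval by (rule prob_space_unit_interval)
  interpret P: pair_prob_space \<sigma> unit_interval ..
  have can1: "canonical_profile N v i t = ?\<beta> t" if "t \<in> {0..1}" for t
    using that i by (simp add: canonical_profile_def)
  have lB: "l i t \<in> B" if "l \<in> \<Lambda>" "t \<in> {0..1}" for l t
    by (rule PiE_mem[OF bid_profiles_component[OF subsetD[OF \<Lambda> that(1)] i] that(2)])
  \<comment> \<open>Membership of the canonical profile in \<open>\<Lambda>\<close> makes its bids
    admissible deviations.\<close>
  have \<beta>B: "?\<beta> t \<in> B" if "t \<in> {0..1}" for t
    using lB[OF can that] can1[OF that] by simp
  have \<beta>mono: "strict_mono_on {0..1} ?\<beta>"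
    using mono[OF can i] can1 by (simp add: monotone_on_def)
  have \<beta>c: "continuous_on {0..1} ?\<beta>"
    by (rule DERIV_continuous_on[OF canonical_bid_has_real_derivative[OF N v]])
  have \<epsilon>0: "0 \<le> t ^ (N - 2) * (?\<beta> 1 - ?\<beta> t)" if "t \<in> {0..1}" for t
    using strict_mono_on_leD[OF \<beta>mono, of t 1] that by simp
  define D where "D l t = regret_density N v (l i) t" for l :: profile and t
  have D_eq: "D l t = t ^ (N - 2) * (?\<beta> 1 - ?\<beta> t) *
      (deviation_util N v i (?\<beta> t) l t - expected_util N v i l t)"
    if "l \<in> \<Lambda>" "t \<in> {0..1}" for l t
  proof -
    have "\<forall>j\<in>{1..N}. l j = l i"
      using sym[OF that(1) _ i] by blast
    from regret_density_eq[OF i this mono[OF that(1) i] that(2)] show ?thesis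
      unfolding D_def by simp
  qed
  have D_int: "(LINT t|unit_interval. D l t) = (LINT t|unit_interval. alpha N v i l t)"
    if l: "l \<in> \<Lambda>" for l
    unfolding D_def
  proof (rule integral_regret_density(3)[where l = l and i = i, OF N v \<beta>mono mono[OF l i] cont[OF l i]])
    show "?\<beta> 0 \<le> l i s" if "s \<in> {0..1}" for s
      using lB[OF l that] B0 by simp
  qed
  have D_meas: "case_prod D \<in> borel_measurable (\<sigma> \<Otimes>\<^sub>M unit_interval)"
  proof -
    have eval[measurable]: "(\<lambda>x. fst x i (snd x)) \<in> borel_measurable (\<sigma> \<Otimes>\<^sub>M unit_interval)"
    proof (rule borel_measurable_eval_pair)
      show "(\<lambda>l. l i t) \<in> borel_measurable \<sigma>" if "t \<in> {0..1}" for t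
        using \<Lambda> bid_profiles_subset_topspace[OF B]
        by (intro borel_measurable_eval[OF borel _ i that]) blast
      show "continuous_on {0..1} (l i)" if "l \<in> space \<sigma>" for l
        using cont[OF _ i] that space by simp
    qed
    have [measurable]: "?\<beta> \<in> borel_measurable unit_interval" "v \<in> borel_measurable unit_interval"
        "(\<lambda>t. t ^ k :: real) \<in> borel_measurable unit_interval" for k
      by (intro continuous_on_borel_measurable_unit_interval \<beta>c v continuous_intros)+
    \<comment> \<open>The inner pair is a profile with the buyer's own type; the last coordinate is
      a rival type \<open>s\<close>, to be integrated out.\<close>
    have [measurable]: "(\<lambda>y. fst (fst y) i (snd y))
        \<in> borel_measurable ((\<sigma> \<Otimes>\<^sub>M unit_interval) \<Otimes>\<^sub>M unit_interval)"
    proof -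
      have "(\<lambda>y. (fst (fst y), snd y))
          \<in> (\<sigma> \<Otimes>\<^sub>M unit_interval) \<Otimes>\<^sub>M unit_interval \<rightarrow>\<^sub>M \<sigma> \<Otimes>\<^sub>M unit_interval"
        by measurable
      from measurable_compose[OF this eval] show ?thesis by simp
    qed
    have "(\<lambda>x. LINT s|unit_interval. of_bool (fst x i s < ?\<beta> (snd x)) :: real)
        \<in> borel_measurable (\<sigma> \<Otimes>\<^sub>M unit_interval)"
      by measurable
    \<comment> \<open>The case \<open>n = 1\<close> of \<open>win_measure_power\<close> turns the
      winning probability into a parameter integral, hence measurable jointly in profile and
      type.\<close>
    moreover have "win_measure (fst x i) b = (LINT s|unit_interval. of_bool (fst x i s < b))"
      if "x \<in> space (\<sigma> \<Otimes>\<^sub>M unit_interval)" for x b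
      using win_measure_power[of "fst x i" 1 b] mono[OF _ i] that
      by (simp add: space_pair_measure mem_Times_iff space)
    ultimately have [measurable]: "(\<lambda>x. win_measure (fst x i) (?\<beta> (snd x)))
        \<in> borel_measurable (\<sigma> \<Otimes>\<^sub>M unit_interval)"
      by (simp cong: measurable_cong)
    show ?thesis
      unfolding D_def regret_density_def Let_def split_beta' by measurable
  qed
  obtain CB where CB: "\<And>b. b \<in> B \<Longrightarrow> \<bar>b\<bar> \<le> CB"
    using B by (auto simp: bounded_iff)
  obtain Cv where Cv: "\<And>t. t \<in> {0..1} \<Longrightarrow> \<bar>v t\<bar> \<le> Cv"
    by (rule bounded_on_unit_interval[OF v]) blast
  \<comment> \<open>A crude bound for Fubini; the ones bound powers of numbers in the unit
    interval.\<close>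
  have D_bound: "\<bar>D l t\<bar> \<le> (1 * (CB + CB)) * ((1 * Cv + CB) + (1 * Cv + CB))"
    if l: "l \<in> \<Lambda>" and t: "t \<in> {0..1}" for l t
  proof -
    have [simp]: "0 \<le> CB" "0 \<le> Cv"
      using CB[OF \<beta>B[OF t]] Cv[OF t] by linarith+
    have W: "\<bar>win_measure (l i) (?\<beta> t) ^ (N - 1) * v t\<bar> \<le> 1 * Cv"
      unfolding abs_mult using Cv[OF t]
      by (intro mult_mono) (auto simp: win_measure_nonneg win_measure_le_1 power_le_one)
    have T: "\<bar>t ^ (N - 1) * v t\<bar> \<le> 1 * Cv"
      unfolding abs_mult using Cv[OF t] t
      by (intro mult_mono) (auto simp: power_le_one)
    have T2: "\<bar>t ^ (N - 2)\<bar> \<le> 1"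
      using t by (simp add: power_le_one)
    have \<beta>: "\<bar>?\<beta> 1 - ?\<beta> t\<bar> \<le> CB + CB"
      using CB[OF \<beta>B[OF t]] CB[OF \<beta>B[of 1]] by simp
    have U: "\<bar>(win_measure (l i) (?\<beta> t) ^ (N - 1) * v t - ?\<beta> t) - (t ^ (N - 1) * v t - l i t)\<bar>
        \<le> (1 * Cv + CB) + (1 * Cv + CB)"
      using W T CB[OF \<beta>B[OF t]] CB[OF lB[OF l t]] by linarith
    show ?thesis
      unfolding D_def regret_density_def Let_def abs_mult
      using T2 \<beta> U by (intro mult_mono mult_nonneg_nonneg) auto
  qed
  have "integrable (\<sigma> \<Otimes>\<^sub>M unit_interval) (case_prod D)"
    using D_bound
    by (intro P.integrable_const_bound[of _ "(1 * (CB + CB)) * ((1 * Cv + CB) + (1 * Cv + CB))"]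
        AE_I2 D_meas)
      (auto simp: space_pair_measure space)
  note F = P.Fubini_integral[OF this] and I_int = P.integrable_fst[OF this]
  have "(LINT t|unit_interval. LINT l|\<sigma>. D l t) \<le> 0"
  proof -
    \<comment> \<open>The equilibrium inequality of type \<open>t\<close> for the constant bid
      \<open>\<beta> t\<close>, times the nonnegative weight \<epsilon>(t).\<close>
    have "(LINT l|\<sigma>. D l t) \<le> 0" if t: "t \<in> {0..1}" for t
    proof -
      have "(LINT l|\<sigma>. D l t) = (LINT l|\<sigma>. t ^ (N - 2) * (?\<beta> 1 - ?\<beta> t) *
          (deviation_util N v i (?\<beta> t) l t - expected_util N v i l t))"
        using D_eq t space by (intro Bochner_Integration.integral_cong) auto
      also have "\<dots> = t ^ (N - 2) * (?\<beta> 1 - ?\<beta> t) *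
          (LINT l|\<sigma>. deviation_util N v i (?\<beta> t) l t - expected_util N v i l t)"
        by (rule integral_mult_right_zero)
      also have "\<dots> \<le> 0"
        using \<sigma> i t \<beta>B[OF t] by (intro mult_nonneg_nonpos \<epsilon>0) (auto simp: BCCE_def)
      finally show ?thesis .
    qed
    then have "0 \<le> (LINT t|unit_interval. - (LINT l|\<sigma>. D l t))"
      by (intro Bochner_Integration.integral_nonneg) auto
    then show ?thesis by simp
  qed
  then have I_le: "(LINT l|\<sigma>. LINT t|unit_interval. D l t) \<le> 0"
    using F by simp
  have I_nonneg: "0 \<le> (LINT t|unit_interval. D l t)" if "l \<in> \<Lambda>" for l
    unfolding D_int[OF that] using strict_mono_on_leD[OF \<beta>mono, of _ 1]
    by (intro Bochner_Integration.integral_nonneg alpha_nonneg) auto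
  have "(LINT l|\<sigma>. LINT t|unit_interval. D l t) = 0"
  proof (rule antisym[OF I_le])
    show "0 \<le> (LINT l|\<sigma>. LINT t|unit_interval. D l t)"
      by (rule Bochner_Integration.integral_nonneg) (simp add: I_nonneg space)
  qed
  then have AE0: "AE l in \<sigma>. (LINT t|unit_interval. D l t) = 0"
    by (subst (asm) integral_nonneg_eq_0_iff_AE[OF I_int]) (auto simp: I_nonneg space intro!: AE_I2)
  \<comment> \<open>As the zero set of a measurable function, the singleton is measurable, and it
    inherits probability 1.\<close>
  have eq: "{l \<in> space \<sigma>. (LINT t|unit_interval. D l t) = 0} = {canonical_profile N v}"
  proof (intro set_eqI iffI)
    fix l assume "l \<in> {l \<in> space \<sigma>. (LINT t|unit_interval. D l t) = 0}"
    then have l: "l \<in> \<Lambda>" and zero: "(LINT t|unit_interval. alpha N v i l t) = 0"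
      using D_int space by auto
    have l1: "l i t = ?\<beta> t" if "t \<in> {0..1}" for t
      by (rule eq_canonical_bid_if_integral_alpha_eq_0[where l = l and i = i, OF N v \<beta>mono cont[OF l i] zero that])
    \<comment> \<open>Symmetry extends the agreement from buyer \<open>i\<close> to all buyers, and
      extensionality upgrades it to equality of profiles.\<close>
    have "l = canonical_profile N v"
    proof (rule PiE_ext)
      show "l \<in> {1..N} \<rightarrow>\<^sub>E ({0..1} \<rightarrow>\<^sub>E B)" "canonical_profile N v \<in> {1..N} \<rightarrow>\<^sub>E ({0..1} \<rightarrow>\<^sub>E B)"
        using l can \<Lambda> by (auto simp: bid_profiles_def)
      fix j assume j: "j \<in> {1..N}"
      show "l j = canonical_profile N v j"
      proof (rule PiE_ext)
        show "l j \<in> {0..1} \<rightarrow>\<^sub>E B" "canonical_profile N v j \<in> {0..1} \<rightarrow>\<^sub>E B"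
          by (rule bid_profiles_component[OF subsetD[OF \<Lambda> l] j]
              bid_profiles_component[OF subsetD[OF \<Lambda> can] j])+
        fix t :: real assume "t \<in> {0..1}"
        then show "l j t = canonical_profile N v j t"
          using l1 can1 sym[OF l j i] sym[OF can j i] by simp
      qed
    qed
    then show "l \<in> {canonical_profile N v}" by simp
  next
    fix l assume "l \<in> {canonical_profile N v}"
    then have l: "l = canonical_profile N v" by simp
    have "(LINT t|unit_interval. alpha N v i l t) = (LINT t|unit_interval. 0)"
    proof (rule Bochner_Integration.integral_cong)
      fix t assume "t \<in> space unit_interval"
      then show "alpha N v i l t = 0"
        using strict_mono_on_leD[OF \<beta>mono, of t 1] can1[of t]
        by (simp add: alpha_def Let_def l)
    qed simp
    then show "l \<in> {l \<in> space \<sigma>. (LINT t|unit_interval. D l t) = 0}"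
      using D_int[of l] can l space by simp
  qed
  have "{l \<in> space \<sigma>. (LINT t|unit_interval. D l t) = 0} \<in> sets \<sigma>"
    using borel_measurable_integrable[OF I_int] by measurable
  from S.prob_Collect_eq_1[OF this] AE0 show ?thesis
    unfolding eq by simp
qed

section \<open>Feasibility of the dual solution and uniqueness of the equilibrium\<close>

theorem theorem4p6:
  fixes N :: nat and F v :: "real \<Rightarrow> real" and V B :: "real set" and Bmax M :: real
    and \<Lambda> :: "profile set" and \<beta> \<epsilon> :: "real \<Rightarrow> real"
  assumes N: "N \<ge> 2"
    and V_def: "V = {0..v 1}"
    and B_def: "B = {0..Bmax}"
    and V_sub_B: "V \<subseteq> B"
    and F: "has_full_support_density F V"
    and v_quantile: "quantile_function F V v"
    and v_cont: "continuous_on {0..1} v"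
    and v_mono: "strict_mono_on {0..1} v"
    and v_smooth: "Cinf_on {0<..1} v"
    and \<beta>_def: "\<beta> = canonical_bid N v"
    and \<epsilon>_def: "\<epsilon> = (\<lambda>t. t ^ (N - 2) * (\<beta> 1 - \<beta> t))"
    and M: "M > 0"
    and \<Lambda>_profiles: "\<Lambda> \<subseteq> bid_profiles N B"
    and \<Lambda>_canonical: "canonical_profile N v \<in> \<Lambda>"
    and \<Lambda>_symmetric: "\<forall>l\<in>\<Lambda>. \<forall>i\<in>{1..N}. \<forall>j\<in>{1..N}. l i = l j"
    and \<Lambda>_mono: "\<forall>l\<in>\<Lambda>. \<forall>i\<in>{1..N}. strict_mono_on {0..1} (l i)"
    and \<Lambda>_diff: "\<forall>l\<in>\<Lambda>. \<forall>i\<in>{1..N}. l i differentiable_on {0..1}"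
    and \<Lambda>_zero: "\<forall>l\<in>\<Lambda>. \<forall>i\<in>{1..N}. l i 0 = 0"
    and \<Lambda>_bound: "\<forall>l\<in>\<Lambda>. \<forall>i\<in>{1..N}. \<forall>t\<in>{0..1}. l i t < M"
  shows "dual_feasible N v \<Lambda> \<epsilon> 0 \<and> dual_objective \<epsilon> 0 = 0 \<and>
    (\<forall>\<sigma>. BCCE N v B \<Lambda> \<sigma> \<longrightarrow> measure \<sigma> {canonical_profile N v} = 1)"
proof (intro conjI allI impI)
  have i1: "1 \<in> {1..N}" using N by simp
  have can1: "canonical_profile N v 1 t = canonical_bid N v t" if "t \<in> {0..1}" for t
    using that i1 by (simp add: canonical_profile_def)
  have sym: "\<forall>j\<in>{1..N}. l j = l i" if "l \<in> \<Lambda>" "i \<in> {1..N}" for l i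
    using \<Lambda>_symmetric that by blast
  have mono: "strict_mono_on {0..1} (l i)" if "l \<in> \<Lambda>" "i \<in> {1..N}" for l i
    using \<Lambda>_mono that by blast
  have cont: "continuous_on {0..1} (l i)" if "l \<in> \<Lambda>" "i \<in> {1..N}" for l i
    using \<Lambda>_diff that by (blast intro: differentiable_imp_continuous_on)
  \<comment> \<open>Inherited from the canonical profile, which belongs to
    \<open>\<Lambda>\<close>.\<close>
  have \<beta>mono: "strict_mono_on {0..1} (canonical_bid N v)"
    using mono[OF \<Lambda>_canonical i1] can1 by (simp add: monotone_on_def)
  have \<beta>c: "continuous_on {0..1} (canonical_bid N v)"
    by (rule DERIV_continuous_on[OF canonical_bid_has_real_derivative[OF N v_cont]])
  show "dual_feasible N v \<Lambda> \<epsilon> 0"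
    unfolding dual_feasible_def
  proof (intro conjI ballI)
    show "continuous_on {0..1} \<epsilon>"
      unfolding \<epsilon>_def \<beta>_def by (intro continuous_intros \<beta>c)
    show "0 \<le> \<epsilon> t" if "t \<in> {0..1}" for t
      using strict_mono_on_leD[OF \<beta>mono, of t 1] that by (simp add: \<epsilon>_def \<beta>_def)
  next
    fix l assume l: "l \<in> \<Lambda>"
    let ?r = "\<lambda>i t. \<epsilon> t * (deviation_util N v i (canonical_bid N v t) l t - expected_util N v i l t)"
    have regret: "?r i t = regret_density N v (l i) t" if "i \<in> {1..N}" "t \<in> {0..1}" for i t
      unfolding \<epsilon>_def \<beta>_def
      by (rule regret_density_eq[OF that(1) sym[OF l that(1)] mono[OF l that(1)] that(2)])
    have nonneg: "canonical_bid N v 0 \<le> l i s" if "i \<in> {1..N}" "s \<in> {0..1}" for i s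
      using PiE_mem[OF bid_profiles_component[OF subsetD[OF \<Lambda>_profiles l] that(1)] that(2)]
      by (simp add: B_def)
    note dens = integral_regret_density[where l = l, OF N v_cont \<beta>mono mono[OF l] cont[OF l] nonneg]
    show "integrable unit_interval (?r i)" if i: "i \<in> {1..N}" for i
      using dens(1)[OF i i i] regret[OF i]
      by (subst Bochner_Integration.integrable_cong[OF refl]) simp_all
    show "integrable unit_interval (alpha N v i l)" if i: "i \<in> {1..N}" for i
      by (rule dens(2)[OF i i i])
    \<comment> \<open>Equality holds buyer by buyer, so the summed constraint is tight with \<gamma>
      = 0.\<close>
    have "(LINT t|unit_interval. ?r i t) = (LINT t|unit_interval. alpha N v i l t)"
      if i: "i \<in> {1..N}" for i
    proof -
      have "(LINT t|unit_interval. ?r i t) = (LINT t|unit_interval. regret_density N v (l i) t)"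
        by (rule Bochner_Integration.integral_cong) (simp_all add: regret[OF i])
      then show ?thesis
        using dens(3)[OF i i i] by simp
    qed
    then show "(\<Sum>i\<in>{1..N}. LINT t|unit_interval. alpha N v i l t) \<le>
        0 + (\<Sum>i\<in>{1..N}. LINT t|unit_interval. ?r i t)"
      by simp
  qed
  show "dual_objective \<epsilon> 0 = 0"
    by (simp add: dual_objective_def)
  show "measure \<sigma> {canonical_profile N v} = 1" if "BCCE N v B \<Lambda> \<sigma>" for \<sigma>
  proof (rule measure_canonical_profile_BCCE[OF N v_cont that _ _ \<Lambda>_profiles \<Lambda>_canonical])
    show "strict_mono_on {0..1} (l i)" "continuous_on {0..1} (l i)"
      if "l \<in> \<Lambda>" "i \<in> {1..N}" for l i
      using that by (rule mono cont)+
    show "l i = l j" if "l \<in> \<Lambda>" "i \<in> {1..N}" "j \<in> {1..N}" for l i j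
      using \<Lambda>_symmetric that by blast
  qed (simp_all add: B_def)
qed

end
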